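(* Let $\hat{\mathcal L}=\sum_{j=0}^d\mathcal L_j(x)\lambda^{d-j}$ be a multiplicative operator, polynomial of degree $d$ in $\lambda$ ($d$ a positive integer), with $\mathcal L_0\neq 0$ constant, and let $\phi_n,\phi_{n-1},\dots,\phi_0$ be the normalized solitons associated to $\hat{\mathcal L}$. (A) Each $n$-soliton $\psi_n=\sum_{k=0}^n B_k(x)\lambda^{n-k}$ associated to $\hat{\mathcal L}$ can be written as a linear combination (with constant coefficients) of the normalized solitons $\phi_n,\phi_{n-1},\dots,\phi_0$. (B) The linear combination $$\psi_n=K_0\phi_n+K_1\phi_{n-1}+\dots+K_n\phi_0$$ (with $K_i$ constant for $0\le i\le n$ and $K_0\neq 0$) is an $n$-soliton solution if, and only if, it satisfies the conditions $$\mathcal B_{n,s}=\sum_{l=0}^n K_l\,\mathcal A_{n-l,s}=0\qquad\text{for } 0\le s\le d-1,$$ where, with $A_k$ the coefficients of the normalized solitons and $B_k$ those of $\psi_n$, $$\mathcal A_{m,s}:=A_{m-s}'''-2\sum_{i=d-s}^{d}\langle\mathcal L_i,A_{d+m-s-i}\rangle,\qquad \mathcal B_{n,s}:=B_{n-s}'''-2\sum_{i=d-s}^{d}\langle\mathcal L_i,B_{d+n-s-i}\rangle$$ (coefficients with negative index are zero). Since $\mathcal A_{n-l,s}=0$ is the $s$-th condition for the normalized soliton $\phi_{n-l}$, $\mathcal B_{n,s}=0$ is the $s$-th condition for the soliton $\psi_n$; that is, similar conditions hold for $\psi_n$.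
   Context: Here $'$ denotes $d/dx$, $\lambda$ is a constant (the spectral parameter), and "constant" means $x$-independent. $\hat{\mathcal L}(x;\lambda)=\mathcal L_0\lambda^d+\mathcal L_1(x)\lambda^{d-1}+\dots+\mathcal L_d(x)$ acts by multiplication. Bilinear operator: $\langle\psi,\phi\rangle:=(\psi\phi)'+\psi\phi'=\psi'\phi+2\psi\phi'$. Soliton equation: $\phi'''-2\langle\hat{\mathcal L},\phi\rangle=0$. An $n$-soliton solution associated to $\hat{\mathcal L}$ is a solution $\psi_n$ of this equation that is a polynomial of degree $n$ in $\lambda$, with nonzero constant leading coefficient and remaining coefficients functions of $x$. Recursion formula: setting to zero the coefficients of $\lambda^{d+n-k}$, $1\le k\le n$, in the soliton equation for $\phi_n=\sum_{k=0}^nA_k\lambda^{n-k}$ gives $$A_k=-\frac1{2\mathcal L_0}\Big(\int\sum_{i=1}^d\langle\mathcal L_i,A_{k-i}\rangle\,dx-\tfrac12A_{k-d}''\Big),\qquad k=1,\dots,n,$$ with $A_{-l}=0$ for $l>0$. Setting to zero the coefficients of $\lambda^s$, $0\le s\le d-1$, gives the $d$ additional conditions $\mathcal A_{n,s}=0$ (the $s$-th condition). The normalized $n$-soliton $\phi_n$ associated to $\hat{\mathcal L}$ is defined as the solution of the soliton equation obtained by the recursion formula, assuming $A_0=-2\mathcal L_0$ and that all the constants of integration in the recursion formula are zero. *)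

theory Defs
  imports "HOL-Analysis.Analysis" "HOL-Library.Poly_Mapping" "HOL-Library.Multiset"
begin

text \<open>
  Functions of the real variable x take values in a real normed field, i.e. they are real- or
  complex-valued.  They are only relevant on an open interval S.
\<close>

abbreviation Dx :: "(real \<Rightarrow> 'a::real_normed_field) \<Rightarrow> real \<Rightarrow> 'a" where
  "Dx f \<equiv> \<lambda>x. vector_derivative f (at x)"

definition smooth_fun_on :: "real set \<Rightarrow> (real \<Rightarrow> 'a::real_normed_field) \<Rightarrow> bool" where
  "smooth_fun_on S f \<longleftrightarrow> (\<forall>k. \<forall>x\<in>S. (Dx ^^ k) f differentiable (at x))"

definition bilin :: "(real \<Rightarrow> 'a::real_normed_field) \<Rightarrow> (real \<Rightarrow> 'a) \<Rightarrow> real \<Rightarrow> 'a" where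
  "bilin f g = (\<lambda>x. Dx (\<lambda>y. f y * g y) x + f x * Dx g x)"

definition lam_poly :: "nat \<Rightarrow> (nat \<Rightarrow> real \<Rightarrow> 'a::real_normed_field) \<Rightarrow> 'a \<Rightarrow> real \<Rightarrow> 'a" where
  "lam_poly n C lam = (\<lambda>x. \<Sum>k\<le>n. C k x * lam ^ (n - k))"

text \<open>
  The left-hand side of the soliton equation for the polynomial with coefficients \<open>C 0, \<dots>, C n\<close>;
  the operator acts as multiplication by \<open>lam_poly d L lam\<close>.
\<close>

definition soliton_lhs ::
  "nat \<Rightarrow> (nat \<Rightarrow> real \<Rightarrow> 'a::real_normed_field) \<Rightarrow> nat \<Rightarrow> (nat \<Rightarrow> real \<Rightarrow> 'a) \<Rightarrow> 'a \<Rightarrow> real \<Rightarrow> 'a" where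
  "soliton_lhs d L n C lam = (\<lambda>x. Dx (Dx (Dx (lam_poly n C lam))) x
      - 2 * bilin (lam_poly d L lam) (lam_poly n C lam) x)"

definition soliton ::
  "real set \<Rightarrow> nat \<Rightarrow> (nat \<Rightarrow> real \<Rightarrow> 'a::real_normed_field) \<Rightarrow> nat \<Rightarrow> (nat \<Rightarrow> real \<Rightarrow> 'a) \<Rightarrow> bool" where
  "soliton S d L n B \<longleftrightarrow>
     (\<exists>b. b \<noteq> 0 \<and> (\<forall>x\<in>S. B 0 x = b)) \<and>
     (\<forall>k\<le>n. smooth_fun_on S (B k)) \<and>
     (\<forall>lam. \<forall>x\<in>S. soliton_lhs d L n B lam x = 0)"

definition coeff_at :: "(nat \<Rightarrow> real \<Rightarrow> 'a::real_normed_field) \<Rightarrow> int \<Rightarrow> real \<Rightarrow> 'a" where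
  "coeff_at C j = (if j < 0 then (\<lambda>x. 0) else C (nat j))"

definition soliton_cond ::
  "nat \<Rightarrow> (nat \<Rightarrow> real \<Rightarrow> 'a::real_normed_field) \<Rightarrow> (nat \<Rightarrow> real \<Rightarrow> 'a) \<Rightarrow> nat \<Rightarrow> nat \<Rightarrow> real \<Rightarrow> 'a" where
  "soliton_cond d L C m s = (\<lambda>x. Dx (Dx (Dx (coeff_at C (int m - int s)))) x
      - 2 * (\<Sum>i=d-s..d. bilin (L i) (coeff_at C (int d + int m - int s - int i)) x))"

text \<open>
  The integrals in the recursion formula have a well-defined constant of integration only when the
  integrands are read as differential polynomials in the coefficients \<open>L 1, \<dots>, L d\<close>: every
  integrand is then a total derivative (multiply the soliton equation by its solution), and its
  primitive is unique up to an additive constant, the constant term.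

  A variable \<open>(i, j)\<close> stands for the \<open>j\<close>-th derivative of \<open>L i\<close>, a monomial is
  a multiset of variables, and the product of \<open>('a) dpoly\<close> is the convolution product.
\<close>

type_synonym 'a dpoly = "(nat \<times> nat) multiset \<Rightarrow>\<^sub>0 'a"

definition dconst :: "'a::real_normed_field \<Rightarrow> 'a dpoly" where
  "dconst c = Poly_Mapping.single {#} c"

definition dvar :: "nat \<Rightarrow> 'a::real_normed_field dpoly" where
  "dvar i = Poly_Mapping.single {#(i, 0)#} 1"

text \<open>The total derivative: the Leibniz rule on monomials, where \<open>(i, j)\<close> goes to \<open>(i, j + 1)\<close>.\<close>

definition dtot :: "'a::real_normed_field dpoly \<Rightarrow> 'a dpoly" where
  "dtot P = (\<Sum>M\<in>Poly_Mapping.keys P. \<Sum>v\<in>#M.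
      Poly_Mapping.single (M - {#v#} + {#(fst v, Suc (snd v))#}) (Poly_Mapping.lookup P M))"

definition dbilin :: "'a::real_normed_field dpoly \<Rightarrow> 'a dpoly \<Rightarrow> 'a dpoly" where
  "dbilin P Q = dtot (P * Q) + P * dtot Q"

definition deval :: "(nat \<Rightarrow> real \<Rightarrow> 'a::real_normed_field) \<Rightarrow> 'a dpoly \<Rightarrow> real \<Rightarrow> 'a" where
  "deval L P = (\<lambda>x. \<Sum>M\<in>Poly_Mapping.keys P.
      Poly_Mapping.lookup P M * (\<Prod>v\<in>#M. (Dx ^^ snd v) (L (fst v)) x))"

definition zero_const_primitive :: "'a::real_normed_field dpoly \<Rightarrow> 'a dpoly \<Rightarrow> bool" where
  "zero_const_primitive Q P \<longleftrightarrow> dtot Q = P \<and> Poly_Mapping.lookup Q {#} = 0"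

definition dcoeff_at :: "(nat \<Rightarrow> 'a::real_normed_field dpoly) \<Rightarrow> int \<Rightarrow> 'a dpoly" where
  "dcoeff_at P j = (if j < 0 then 0 else P (nat j))"

definition normalized_recursion ::
  "nat \<Rightarrow> 'a::real_normed_field \<Rightarrow> (nat \<Rightarrow> 'a dpoly) \<Rightarrow> bool" where
  "normalized_recursion d L0 P \<longleftrightarrow>
     P 0 = dconst (- 2 * L0) \<and>
     (\<forall>k\<ge>1. \<exists>Q.
        zero_const_primitive Q (\<Sum>i=1..d. dbilin (dvar i) (dcoeff_at P (int k - int i))) \<and>
        P k = dconst (- 1 / (2 * L0)) *
          (Q - dconst (1 / 2) * dtot (dtot (dcoeff_at P (int k - int d)))))"

text \<open>
  The recursion for the k-th coefficient does not involve the degree of the soliton, so one sequence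
  \<open>A\<close> serves all degrees: the normalized m-soliton is \<open>lam_poly m A\<close>.  The recursion alone
  does not make it solve the soliton equation; that is the vanishing of \<open>soliton_cond d L A m s\<close>
  for all \<open>s < d\<close>.
\<close>

definition normalized_coeffs ::
  "real set \<Rightarrow> nat \<Rightarrow> 'a::real_normed_field \<Rightarrow> (nat \<Rightarrow> real \<Rightarrow> 'a) \<Rightarrow> (nat \<Rightarrow> real \<Rightarrow> 'a) \<Rightarrow> bool" where
  "normalized_coeffs S d L0 L A \<longleftrightarrow>
     (\<exists>P. normalized_recursion d L0 P \<and> (\<forall>k. \<forall>x\<in>S. A k x = deval L (P k) x))"

end

theory Submission
  imports Defs
begin

text \<open>
  The third derivative and the bilinear operator are linear in the unknown \<open>\<psi>\<close>, so the left-hand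
  side of the soliton equation is a polynomial in \<open>\<lambda>\<close> whose coefficients are linear in the
  coefficients of \<open>\<psi>\<close>.  The coefficient of \<open>\<lambda>\<^sup>s\<close> is the quantity \<open>soliton_cond\<close>, and not
  only for \<open>s < d\<close>: the same formula is right for every \<open>s \<le> d + n\<close>
  (\<open>soliton_lhs_eq_sum_conds\<close>).  As a polynomial that vanishes at all points of an infinite field
  is zero, the soliton equation says that all these quantities vanish.

  For \<open>s \<ge> d\<close> the vanishing depends on \<open>k = d + n - s\<close> alone and is the differentiated
  recursion formula, which expresses \<open>L0 * A\<^sub>k'\<close> through \<open>A\<^sub>0, \<dots>, A\<^sub>k\<^sub>-\<^sub>1\<close>
  (\<open>soliton_cond_d_eq_0_iff\<close>).  The normalized coefficients satisfy it for all \<open>k\<close>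
  (\<open>normalized_soliton_cond_eq_0\<close>), and by linearity so does every combination
  \<open>\<Sum>l. K\<^sub>l * \<phi>\<^sub>n\<^sub>-\<^sub>l\<close>, whose \<open>k\<close>-th coefficient is \<open>\<Sum>l\<le>k. K\<^sub>l * A\<^sub>k\<^sub>-\<^sub>l\<close>.

  For part (A), two solutions of the differentiated recursion that agree up to index \<open>k - 1\<close> have
  \<open>k\<close>-th coefficients with the same derivative, which on an interval differ by a constant.  Since
  \<open>A\<^sub>0\<close> is a nonzero constant, a suitable \<open>K\<^sub>k\<close> absorbs that constant; it changes no earlier
  coefficient, so the \<open>K\<^sub>k\<close> can be chosen one after the other (\<open>comb_of_soliton_conds\<close>).
  For part (B), the coefficients of \<open>\<lambda>\<^sup>s\<close> with \<open>s \<ge> d\<close> vanish automatically, and those with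
  \<open>s < d\<close> are the stated conditions.

  The normalized coefficients are given as differential polynomials, and evaluation turns the total
  derivative into the derivative in \<open>x\<close> only for polynomials in functions that are smooth.  The
  primitives in the recursion are not assumed to involve only \<open>L 1, \<dots>, L d\<close>; that they do
  follows because no function \<open>L i\<close> disappears under the total derivative
  (\<open>dpoly_over_dtot_iff\<close>).
\<close>

section \<open>Iterated derivatives of smooth functions\<close>

lemma Dx_cong:
  assumes "open S" "x \<in> S" "\<And>y. y \<in> S \<Longrightarrow> f y = g y"
  shows "Dx f x = Dx g x"
proof -
  have "eventually (\<lambda>y. y \<in> S) (nhds x)"
    using assms eventually_nhds by blast
  then have "eventually (\<lambda>y. y \<in> UNIV \<longrightarrow> f y = g y) (nhds x)"
    by (rule eventually_mono) (use assms in auto)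
  from vector_derivative_cong_eq[OF this refl refl] show ?thesis by simp
qed

lemma Dx_pow_cong:
  assumes "open S" "\<And>y. y \<in> S \<Longrightarrow> f y = g y" "x \<in> S"
  shows "(Dx ^^ k) f x = (Dx ^^ k) g x"
  using assms(3)
proof (induction k arbitrary: x)
  case (Suc k)
  then show ?case using Dx_cong[OF assms(1) Suc.prems, of "(Dx ^^ k) f" "(Dx ^^ k) g"] by simp
qed (use assms in auto)

lemma bilin_cong:
  assumes "open S" "x \<in> S" "\<And>y. y \<in> S \<Longrightarrow> f y = f' y" "\<And>y. y \<in> S \<Longrightarrow> g y = g' y"
  shows "bilin f g x = bilin f' g' x"
  unfolding bilin_def
  using Dx_cong[OF assms(1,2), of "\<lambda>y. f y * g y" "\<lambda>y. f' y * g' y"]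
    Dx_cong[OF assms(1,2), of g g'] assms by simp

lemma smooth_has_vector_derivative:
  assumes "smooth_fun_on S f" "x \<in> S"
  shows "((Dx ^^ k) f has_vector_derivative (Dx ^^ Suc k) f x) (at x)"
  using assms unfolding smooth_fun_on_def by (simp add: vector_derivative_works)

lemma smooth_cong:
  assumes "open S" "smooth_fun_on S f" "\<And>y. y \<in> S \<Longrightarrow> f y = g y"
  shows "smooth_fun_on S g"
  unfolding smooth_fun_on_def
proof (intro allI ballI)
  fix k x assume x: "x \<in> S"
  have "((Dx ^^ k) g has_vector_derivative (Dx ^^ Suc k) f x) (at x)"
    by (rule has_vector_derivative_transform_within_open[OF
        smooth_has_vector_derivative[OF assms(2) x, of k] assms(1) x])
      (rule Dx_pow_cong[OF assms(1,3)])
  then show "(Dx ^^ k) g differentiable at x" by (rule differentiableI_vector)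
qed

lemma Dx_pow_sum:
  assumes "open S" "finite F" "\<And>i. i \<in> F \<Longrightarrow> smooth_fun_on S (f i)" "x \<in> S"
  shows "(Dx ^^ k) (\<lambda>y. \<Sum>i\<in>F. c i * f i y) x = (\<Sum>i\<in>F. c i * (Dx ^^ k) (f i) x)"
  using assms(4)
proof (induction k arbitrary: x)
  case (Suc k)
  have "((\<lambda>y. \<Sum>i\<in>F. c i * (Dx ^^ k) (f i) y) has_vector_derivative
      (\<Sum>i\<in>F. c i * (Dx ^^ Suc k) (f i) x)) (at x)"
    by (intro has_vector_derivative_sum has_vector_derivative_mult_right
        smooth_has_vector_derivative[where S = S] assms(3) Suc.prems)
  then have "((Dx ^^ k) (\<lambda>y. \<Sum>i\<in>F. c i * f i y) has_vector_derivative
      (\<Sum>i\<in>F. c i * (Dx ^^ Suc k) (f i) x)) (at x)"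
    by (rule has_vector_derivative_transform_within_open[OF _ assms(1) Suc.prems])
      (simp add: Suc.IH)
  then show ?case by (simp add: vector_derivative_at)
qed auto

lemma smooth_sum:
  assumes "open S" "finite F" "\<And>i. i \<in> F \<Longrightarrow> smooth_fun_on S (f i)"
  shows "smooth_fun_on S (\<lambda>y. \<Sum>i\<in>F. c i * f i y)"
  unfolding smooth_fun_on_def
proof (intro allI ballI)
  fix k x assume x: "x \<in> S"
  have "((\<lambda>y. \<Sum>i\<in>F. c i * (Dx ^^ k) (f i) y) has_vector_derivative
      (\<Sum>i\<in>F. c i * (Dx ^^ Suc k) (f i) x)) (at x)"
    by (intro has_vector_derivative_sum has_vector_derivative_mult_right
        smooth_has_vector_derivative[where S = S] assms(3) x)
  then have "((Dx ^^ k) (\<lambda>y. \<Sum>i\<in>F. c i * f i y) has_vector_derivative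
      (\<Sum>i\<in>F. c i * (Dx ^^ Suc k) (f i) x)) (at x)"
    by (rule has_vector_derivative_transform_within_open[OF _ assms(1) x])
      (simp add: Dx_pow_sum[OF assms(1-3)])
  then show "(Dx ^^ k) (\<lambda>y. \<Sum>i\<in>F. c i * f i y) differentiable at x"
    by (rule differentiableI_vector)
qed

lemma smooth_const: "smooth_fun_on S (\<lambda>x. c)"
proof -
  have "(Dx ^^ k) (\<lambda>x. c) = (if k = 0 then (\<lambda>x. c) else (\<lambda>x. 0))" for k
    by (induction k) auto
  then show ?thesis unfolding smooth_fun_on_def by simp
qed

lemma bilin_eq:
  assumes "smooth_fun_on S f" "smooth_fun_on S g" "x \<in> S"
  shows "bilin f g x = Dx f x * g x + 2 * (f x * Dx g x)"
  using vector_derivative_at[OF has_vector_derivative_mult[OF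
      smooth_has_vector_derivative[OF assms(1,3), of 0] smooth_has_vector_derivative[OF assms(2,3), of 0]]]
  by (simp add: bilin_def)

lemma bilin_sum_right:
  assumes "open S" "finite F" "smooth_fun_on S f" "\<And>i. i \<in> F \<Longrightarrow> smooth_fun_on S (g i)" "x \<in> S"
  shows "bilin f (\<lambda>y. \<Sum>i\<in>F. c i * g i y) x = (\<Sum>i\<in>F. c i * bilin f (g i) x)"
proof -
  have "Dx (\<lambda>y. \<Sum>i\<in>F. c i * g i y) x = (\<Sum>i\<in>F. c i * Dx (g i) x)"
    using Dx_pow_sum[OF assms(1,2,4,5), where k = 1] by simp
  moreover have "smooth_fun_on S (\<lambda>y. \<Sum>i\<in>F. c i * g i y)"
    by (rule smooth_sum) (use assms in auto)
  ultimately have "bilin f (\<lambda>y. \<Sum>i\<in>F. c i * g i y) x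
      = Dx f x * (\<Sum>i\<in>F. c i * g i x) + 2 * (f x * (\<Sum>i\<in>F. c i * Dx (g i) x))"
    using bilin_eq[OF assms(3) _ assms(5)] by simp
  also have "\<dots> = (\<Sum>i\<in>F. c i * (Dx f x * g i x + 2 * (f x * Dx (g i) x)))"
    by (simp add: sum_distrib_left distrib_left sum.distrib mult_ac)
  also have "\<dots> = (\<Sum>i\<in>F. c i * bilin f (g i) x)"
    by (intro sum.cong refl) (simp add: bilin_eq[OF assms(3) assms(4) assms(5)])
  finally show ?thesis .
qed

lemma bilin_sum_left:
  assumes "open S" "finite F" "smooth_fun_on S g" "\<And>i. i \<in> F \<Longrightarrow> smooth_fun_on S (f i)" "x \<in> S"
  shows "bilin (\<lambda>y. \<Sum>i\<in>F. c i * f i y) g x = (\<Sum>i\<in>F. c i * bilin (f i) g x)"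
proof -
  have "Dx (\<lambda>y. \<Sum>i\<in>F. c i * f i y) x = (\<Sum>i\<in>F. c i * Dx (f i) x)"
    using Dx_pow_sum[OF assms(1,2,4,5), where k = 1] by simp
  moreover have "smooth_fun_on S (\<lambda>y. \<Sum>i\<in>F. c i * f i y)"
    by (rule smooth_sum) (use assms in auto)
  ultimately have "bilin (\<lambda>y. \<Sum>i\<in>F. c i * f i y) g x
      = (\<Sum>i\<in>F. c i * Dx (f i) x) * g x + 2 * ((\<Sum>i\<in>F. c i * f i x) * Dx g x)"
    using bilin_eq[OF _ assms(3) assms(5)] by simp
  also have "\<dots> = (\<Sum>i\<in>F. c i * (Dx (f i) x * g x + 2 * (f i x * Dx g x)))"
    by (simp add: sum_distrib_left sum_distrib_right distrib_left sum.distrib mult_ac)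
  also have "\<dots> = (\<Sum>i\<in>F. c i * bilin (f i) g x)"
    by (intro sum.cong refl) (simp add: bilin_eq[OF assms(4) assms(3) assms(5)])
  finally show ?thesis .
qed

section \<open>Differential polynomials as functions\<close>

lemma sum_of_monomials:
  "P = (\<Sum>M\<in>Poly_Mapping.keys P. Poly_Mapping.single M (Poly_Mapping.lookup P M))"
proof (rule poly_mapping_eqI)
  fix N
  have "(\<Sum>M\<in>Poly_Mapping.keys P. (Poly_Mapping.lookup P M when M = N)) =
      (\<Sum>M\<in>Poly_Mapping.keys P. if M = N then Poly_Mapping.lookup P M else 0)"
    by (simp add: when_def)
  then show "Poly_Mapping.lookup P N = Poly_Mapping.lookup
      (\<Sum>M\<in>Poly_Mapping.keys P. Poly_Mapping.single M (Poly_Mapping.lookup P M)) N"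
    by (simp add: lookup_sum lookup_single sum.delta in_keys_iff)
qed

text \<open>
  For a sum of polynomials the sets of monomials differ; this lets all evaluations run over a common one.
\<close>

lemma deval_superset:
  assumes "finite F" "Poly_Mapping.keys P \<subseteq> F"
  shows "deval L P x = (\<Sum>M\<in>F. Poly_Mapping.lookup P M * (\<Prod>v\<in>#M. (Dx ^^ snd v) (L (fst v)) x))"
  unfolding deval_def by (rule sum.mono_neutral_left) (use assms in \<open>auto simp: in_keys_iff\<close>)

lemma deval_add: "deval L (P + Q) x = deval L P x + deval L Q x"
proof -
  let ?F = "Poly_Mapping.keys P \<union> Poly_Mapping.keys Q"
  have "finite ?F" "Poly_Mapping.keys (P + Q) \<subseteq> ?F" using keys_add[of P Q] by auto
  then show ?thesis
    by (simp add: deval_superset[of ?F] lookup_add distrib_right sum.distrib)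
qed

lemma deval_zero [simp]: "deval L 0 x = 0"
  by (simp add: deval_def)

lemma deval_diff: "deval L (P - Q) x = deval L P x - deval L Q x"
  using deval_add[of L "P - Q" Q x] by simp

lemma deval_sum: "deval L (\<Sum>i\<in>F. P i) x = (\<Sum>i\<in>F. deval L (P i) x)"
  by (induction F rule: infinite_finite_induct) (auto simp: deval_add)

lemma deval_sum_mset: "deval L (\<Sum>v\<in>#M. P v) x = (\<Sum>v\<in>#M. deval L (P v) x)"
  by (induction M) (auto simp: deval_add)

lemma deval_single:
  "deval L (Poly_Mapping.single M c) x = c * (\<Prod>v\<in>#M. (Dx ^^ snd v) (L (fst v)) x)"
  by (subst deval_superset[of "{M}"]) auto

lemma deval_mult: "deval L (P * Q) x = deval L P x * deval L Q x"
proof -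
  let ?m = "\<lambda>P M. Poly_Mapping.single M (Poly_Mapping.lookup P M)"
  have "deval L (P * Q) x
      = deval L ((\<Sum>M\<in>Poly_Mapping.keys P. ?m P M) * (\<Sum>N\<in>Poly_Mapping.keys Q. ?m Q N)) x"
    by (simp flip: sum_of_monomials)
  also have "\<dots> = deval L (\<Sum>M\<in>Poly_Mapping.keys P. ?m P M) x
      * deval L (\<Sum>N\<in>Poly_Mapping.keys Q. ?m Q N) x"
    by (simp add: sum_product deval_sum mult_single deval_single mult_ac)
  finally show ?thesis by (simp flip: sum_of_monomials)
qed

lemma deval_dconst [simp]: "deval L (dconst c) x = c"
  by (simp add: dconst_def deval_single)

lemma deval_dvar [simp]: "deval L (dvar i) x = L i x"
  by (simp add: dvar_def deval_single)

section \<open>The total derivative and the variables that occur\<close>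

definition dpoly_over :: "nat set \<Rightarrow> 'a::real_normed_field dpoly \<Rightarrow> bool" where
  "dpoly_over I P \<longleftrightarrow> (\<forall>M\<in>Poly_Mapping.keys P. \<forall>v\<in>#M. fst v \<in> I)"

lemma dpoly_over_zero: "dpoly_over I 0"
  by (simp add: dpoly_over_def)

lemma dpoly_over_add: "dpoly_over I P \<Longrightarrow> dpoly_over I Q \<Longrightarrow> dpoly_over I (P + Q)"
  unfolding dpoly_over_def using keys_add[of P Q] by blast

lemma dpoly_over_diff: "dpoly_over I P \<Longrightarrow> dpoly_over I Q \<Longrightarrow> dpoly_over I (P - Q)"
  unfolding dpoly_over_def using keys_diff[of P Q] by blast

lemma dpoly_over_sum: "(\<And>i. i \<in> F \<Longrightarrow> dpoly_over I (P i)) \<Longrightarrow> dpoly_over I (\<Sum>i\<in>F. P i)"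
  by (induction F rule: infinite_finite_induct) (auto simp: dpoly_over_zero dpoly_over_add)

lemma dpoly_over_sum_mset: "(\<And>v. v \<in># M \<Longrightarrow> dpoly_over I (P v)) \<Longrightarrow> dpoly_over I (\<Sum>v\<in>#M. P v)"
  by (induction M) (auto simp: dpoly_over_zero dpoly_over_add)

lemma dpoly_over_mult:
  assumes "dpoly_over I P" "dpoly_over I Q"
  shows "dpoly_over I (P * Q)"
  unfolding dpoly_over_def
proof (intro ballI)
  fix M v assume "M \<in> Poly_Mapping.keys (P * Q)" and v: "v \<in># M"
  then obtain M1 M2 where "M = M1 + M2" "M1 \<in> Poly_Mapping.keys P" "M2 \<in> Poly_Mapping.keys Q"
    using keys_mult[of P Q] by blast
  then show "fst v \<in> I" using v assms unfolding dpoly_over_def by auto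
qed

lemma dpoly_over_dconst: "dpoly_over I (dconst c)"
  by (simp add: dpoly_over_def dconst_def)

lemma dpoly_over_dvar: "i \<in> I \<Longrightarrow> dpoly_over I (dvar i)"
  by (simp add: dpoly_over_def dvar_def)

lemma dpoly_over_dtot:
  assumes "dpoly_over I P"
  shows "dpoly_over I (dtot P)"
  unfolding dtot_def
proof (intro dpoly_over_sum dpoly_over_sum_mset)
  fix M v assume M: "M \<in> Poly_Mapping.keys P" and v: "v \<in># M"
  have "fst u \<in> I" if "u \<in># M" for u using assms M that unfolding dpoly_over_def by auto
  then show "dpoly_over I (Poly_Mapping.single (M - {#v#} + {#(fst v, Suc (snd v))#})
      (Poly_Mapping.lookup P M))"
    using v by (auto simp: dpoly_over_def dest: in_diffD)
qed

lemma dpoly_over_dbilin: "dpoly_over I P \<Longrightarrow> dpoly_over I Q \<Longrightarrow> dpoly_over I (dbilin P Q)"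
  by (simp add: dbilin_def dpoly_over_add dpoly_over_mult dpoly_over_dtot)

lemma lookup_sum_mset:
  "Poly_Mapping.lookup (\<Sum>v\<in>#M. P v) N = (\<Sum>v\<in>#M. Poly_Mapping.lookup (P v) N)"
  by (induction M) (auto simp: lookup_add)

lemma sum_mset_eq_count_mult:
  assumes "\<And>u. u \<in># M \<Longrightarrow> f u = (if u = v then c else (0::'a::comm_semiring_1))"
  shows "(\<Sum>u\<in>#M. f u) = of_nat (count M v) * c"
  using assms by (induction M) (auto simp: algebra_simps)

text \<open>
  Suppose that \<open>Q\<close> involves \<open>L i\<close>, and let \<open>v\<close> be its derivative of highest order in \<open>Q\<close>.
  Differentiation produces the variable \<open>w\<close> of the next order, which does not occur in \<open>Q\<close> itself.
  A monomial of the derivative that contains \<open>w\<close> therefore comes from a single monomial of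
  \<open>Q\<close>, by differentiating \<open>v\<close>, and as the characteristic is 0 its coefficient does not vanish.
  So \<open>L i\<close> occurs in the derivative too.
\<close>

lemma dpoly_over_dtot_iff:
  "dpoly_over I (dtot Q) \<longleftrightarrow> dpoly_over I Q"
proof
  assume over: "dpoly_over I (dtot Q)"
  show "dpoly_over I Q"
  proof (rule ccontr)
    assume "\<not> dpoly_over I Q"
    then obtain i j0 M0 where M0: "M0 \<in> Poly_Mapping.keys Q" "(i, j0) \<in># M0" "i \<notin> I"
      unfolding dpoly_over_def by force
    define J where "J = {j. \<exists>M\<in>Poly_Mapping.keys Q. (i, j) \<in># M}"
    have "J \<subseteq> snd ` (\<Union>M\<in>Poly_Mapping.keys Q. set_mset M)"
      unfolding J_def by force
    then have fin: "finite J" by (rule finite_subset) auto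
    have ne: "J \<noteq> {}" using M0 unfolding J_def by blast
    define v w where "v = (i, Max J)" and "w = (i, Suc (Max J))"
    have w: "w \<notin># M" if "M \<in> Poly_Mapping.keys Q" for M
    proof
      assume "w \<in># M"
      then have "Suc (Max J) \<in> J" using that unfolding J_def w_def by blast
      then show False using Max_ge[OF fin] by fastforce
    qed
    obtain M where M: "M \<in> Poly_Mapping.keys Q" "v \<in># M"
      using Max_in[OF fin ne] unfolding J_def v_def by blast
    define T where "T = M - {#v#} + {#w#}"
    have eq: "N - {#u#} + {#(fst u, Suc (snd u))#} = T \<longleftrightarrow> N = M \<and> u = v"
      if N: "N \<in> Poly_Mapping.keys Q" "u \<in># N" for N u
    proof
      assume h: "N - {#u#} + {#(fst u, Suc (snd u))#} = T"
      then have "w \<in># N - {#u#} + {#(fst u, Suc (snd u))#}" by (simp add: T_def)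
      moreover have "w \<notin># N - {#u#}" using w[OF N(1)] by (meson in_diffD)
      ultimately have "(fst u, Suc (snd u)) = w" by auto
      then have u: "u = v" by (auto simp: v_def w_def prod_eq_iff)
      then have "N - {#v#} = M - {#v#}"
        using h by (simp add: T_def v_def w_def)
      then show "N = M \<and> u = v" using N(2) M(2) u by (metis insert_DiffM)
    qed (simp add: T_def v_def w_def)
    have "Poly_Mapping.lookup (dtot Q) T = (\<Sum>N\<in>Poly_Mapping.keys Q. \<Sum>u\<in>#N.
        Poly_Mapping.lookup (Poly_Mapping.single (N - {#u#} + {#(fst u, Suc (snd u))#})
          (Poly_Mapping.lookup Q N)) T)"
      by (simp add: dtot_def lookup_sum lookup_sum_mset)
    also have "\<dots> = (\<Sum>N\<in>Poly_Mapping.keys Q.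
        of_nat (count N v) * (if N = M then Poly_Mapping.lookup Q M else 0))"
    proof (intro sum.cong refl sum_mset_eq_count_mult)
      fix N u assume "N \<in> Poly_Mapping.keys Q" "u \<in># N"
      from eq[OF this] show "Poly_Mapping.lookup (Poly_Mapping.single
          (N - {#u#} + {#(fst u, Suc (snd u))#}) (Poly_Mapping.lookup Q N)) T
        = (if u = v then if N = M then Poly_Mapping.lookup Q M else 0 else 0)"
        unfolding lookup_single when_def by simp
    qed
    also have "\<dots> = (\<Sum>N\<in>Poly_Mapping.keys Q.
        if N = M then of_nat (count N v) * Poly_Mapping.lookup Q M else 0)"
      by (intro sum.cong) auto
    also have "\<dots> = of_nat (count M v) * Poly_Mapping.lookup Q M"
      using M by (simp add: sum.delta)
    also have "\<dots> \<noteq> 0" using M by (auto simp: in_keys_iff)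
    finally have "T \<in> Poly_Mapping.keys (dtot Q)" by (simp add: in_keys_iff)
    moreover have "w \<in># T" by (simp add: T_def)
    ultimately have "fst w \<in> I" using over unfolding dpoly_over_def by blast
    then show False using M0(3) by (simp add: w_def)
  qed
qed (rule dpoly_over_dtot)

lemma has_vector_derivative_monomial:
  fixes g :: "nat \<times> nat \<Rightarrow> real \<Rightarrow> 'a::real_normed_field"
  assumes "\<And>v. v \<in># M \<Longrightarrow> (g v has_vector_derivative g (fst v, Suc (snd v)) x) (at x)"
  shows "((\<lambda>y. \<Prod>v\<in>#M. g v y) has_vector_derivative
    (\<Sum>v\<in>#M. \<Prod>u\<in>#M - {#v#} + {#(fst v, Suc (snd v))#}. g u x)) (at x)"
  using assms
proof (induction M)
  case (add a M)
  have IH: "((\<lambda>y. \<Prod>v\<in>#M. g v y) has_vector_derivative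
    (\<Sum>v\<in>#M. \<Prod>u\<in>#M - {#v#} + {#(fst v, Suc (snd v))#}. g u x)) (at x)"
    by (rule add.IH) (use add.prems in auto)
  have a: "(g a has_vector_derivative g (fst a, Suc (snd a)) x) (at x)"
    using add.prems by auto
  have "(\<Sum>v\<in>#M. \<Prod>u\<in>#add_mset a M - {#v#} + {#(fst v, Suc (snd v))#}. g u x)
      = (\<Sum>v\<in>#M. g a x * (\<Prod>u\<in>#M - {#v#} + {#(fst v, Suc (snd v))#}. g u x))"
    by (intro arg_cong[of _ _ sum_mset] image_mset_cong) (simp add: mult_ac)
  then have "g a x * (\<Sum>v\<in>#M. \<Prod>u\<in>#M - {#v#} + {#(fst v, Suc (snd v))#}. g u x)
      + g (fst a, Suc (snd a)) x * (\<Prod>v\<in>#M. g v x)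
      = (\<Sum>v\<in>#add_mset a M. \<Prod>u\<in>#add_mset a M - {#v#} + {#(fst v, Suc (snd v))#}. g u x)"
    by (simp add: sum_mset_distrib_left)
  moreover have "((\<lambda>y. \<Prod>v\<in>#add_mset a M. g v y) has_vector_derivative
      g a x * (\<Sum>v\<in>#M. \<Prod>u\<in>#M - {#v#} + {#(fst v, Suc (snd v))#}. g u x)
      + g (fst a, Suc (snd a)) x * (\<Prod>v\<in>#M. g v x)) (at x)"
    using has_vector_derivative_mult[OF a IH] by simp
  ultimately show ?case by metis
qed simp

lemma deval_has_vector_derivative:
  assumes L: "\<forall>i\<in>I. smooth_fun_on S (L i)" and P: "dpoly_over I P" and x: "x \<in> S"
  shows "(deval L P has_vector_derivative deval L (dtot P) x) (at x)"
proof -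
  let ?g = "\<lambda>v y. (Dx ^^ snd v) (L (fst v)) y"
  have "deval L (dtot P) x = (\<Sum>M\<in>Poly_Mapping.keys P. Poly_Mapping.lookup P M *
      (\<Sum>v\<in>#M. \<Prod>u\<in>#M - {#v#} + {#(fst v, Suc (snd v))#}. ?g u x))"
    unfolding dtot_def deval_sum deval_sum_mset deval_single
    by (simp add: sum_mset_distrib_left)
  moreover have "((\<lambda>y. \<Sum>M\<in>Poly_Mapping.keys P. Poly_Mapping.lookup P M * (\<Prod>v\<in>#M. ?g v y))
      has_vector_derivative (\<Sum>M\<in>Poly_Mapping.keys P. Poly_Mapping.lookup P M *
      (\<Sum>v\<in>#M. \<Prod>u\<in>#M - {#v#} + {#(fst v, Suc (snd v))#}. ?g u x))) (at x)"
    by (intro has_vector_derivative_sum has_vector_derivative_mult_right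
        has_vector_derivative_monomial)
      (use P L x smooth_has_vector_derivative in \<open>fastforce simp: dpoly_over_def\<close>)
  ultimately show ?thesis by (simp add: deval_def[of L P])
qed

lemma Dx_pow_deval:
  assumes "open S" and L: "\<forall>i\<in>I. smooth_fun_on S (L i)" and P: "dpoly_over I P" and "x \<in> S"
  shows "(Dx ^^ k) (deval L P) x = deval L ((dtot ^^ k) P) x"
  using \<open>x \<in> S\<close>
proof (induction k arbitrary: x)
  case (Suc k)
  have "dpoly_over I ((dtot ^^ k) P)"
    by (induction k) (auto simp: P dpoly_over_dtot)
  from vector_derivative_at[OF deval_has_vector_derivative[OF L this Suc.prems]]
  show ?case using Dx_cong[OF assms(1) Suc.prems Suc.IH] by simp
qed simp

lemma smooth_deval:
  assumes "open S" and L: "\<forall>i\<in>I. smooth_fun_on S (L i)" and P: "dpoly_over I P"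
  shows "smooth_fun_on S (deval L P)"
  unfolding smooth_fun_on_def
proof (intro allI ballI)
  fix k x assume x: "x \<in> S"
  have "dpoly_over I ((dtot ^^ k) P)"
    by (induction k) (auto simp: P dpoly_over_dtot)
  from deval_has_vector_derivative[OF L this x]
  have "((Dx ^^ k) (deval L P) has_vector_derivative deval L (dtot ((dtot ^^ k) P)) x) (at x)"
    by (rule has_vector_derivative_transform_within_open[OF _ assms(1) x])
      (simp add: Dx_pow_deval[OF assms(1) L P])
  then show "(Dx ^^ k) (deval L P) differentiable at x"
    by (rule differentiableI_vector)
qed

lemma bilin_deval:
  assumes "open S" and L: "\<forall>i\<in>I. smooth_fun_on S (L i)"
    and "dpoly_over I P" "dpoly_over I Q" "x \<in> S"
  shows "bilin (deval L P) (deval L Q) x = deval L (dbilin P Q) x"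
proof -
  have "Dx (\<lambda>y. deval L P y * deval L Q y) x = deval L (dtot (P * Q)) x"
    using Dx_pow_deval[of S I L "P * Q" x 1] dpoly_over_mult[of I P Q] assms
    by (simp flip: deval_mult)
  moreover have "Dx (deval L Q) x = deval L (dtot Q) x"
    using Dx_pow_deval[of S I L Q x 1] assms by simp
  ultimately show ?thesis by (simp add: bilin_def dbilin_def deval_add deval_mult)
qed


section \<open>The soliton equation coefficient by coefficient\<close>

lemma lam_poly_powers: "lam_poly n C lam x = (\<Sum>s\<le>n. C (n - s) x * lam ^ s)"
  unfolding lam_poly_def
  by (rule sum.reindex_bij_witness[of _ "\<lambda>s. n - s" "\<lambda>k. n - k"]) auto

lemma lam_poly_eq_iff:
  "(\<forall>lam. lam_poly n B lam x = lam_poly n C lam x) \<longleftrightarrow> (\<forall>k\<le>n. B k x = C k x)"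
proof -
  have "(\<forall>lam. lam_poly n B lam x = lam_poly n C lam x) \<longleftrightarrow> (\<forall>s\<le>n. B (n - s) x = C (n - s) x)"
    unfolding lam_poly_powers by (rule polyfun_eq_coeffs)
  also have "\<dots> \<longleftrightarrow> (\<forall>k\<le>n. B k x = C k x)"
    by (metis diff_diff_cancel diff_le_self)
  finally show ?thesis .
qed

lemma coeff_at_nonneg [simp]: "0 \<le> j \<Longrightarrow> coeff_at C j = C (nat j)"
  by (simp add: coeff_at_def)

lemma coeff_at_neg [simp]: "j < 0 \<Longrightarrow> coeff_at C j = (\<lambda>x. 0)"
  by (simp add: coeff_at_def)

lemma bilin_zero_right [simp]: "bilin f (\<lambda>x. 0) x = 0"
  by (simp add: bilin_def)

text \<open>
  The power \<open>\<lambda>\<^sup>s\<close> in the product of \<open>lam_poly d L\<close> and \<open>lam_poly n C\<close> collects the pairs of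
  \<open>L i\<close> and \<open>C k\<close> with \<open>(d - i) + (n - k) = s\<close>.  The bound \<open>d - s \<le> i\<close> in
  \<open>soliton_cond\<close> says exactly \<open>k \<le> n\<close>, and the convention that coefficients of negative index
  are zero takes care of \<open>0 \<le> k\<close>.  With truncated subtraction the formula stays correct for
  \<open>s \<ge> d\<close>, where all \<open>i \<le> d\<close> contribute.
\<close>

lemma soliton_lhs_eq_sum_conds:
  assumes S: "open S" and L: "\<forall>i\<le>d. smooth_fun_on S (L i)"
    and C: "\<forall>k\<le>n. smooth_fun_on S (C k)" and x: "x \<in> S"
  shows "soliton_lhs d L n C lam x = (\<Sum>s\<le>d + n. soliton_cond d L C n s x * lam ^ s)"
proof -
  let ?D = "\<lambda>f x. Dx (Dx (Dx f)) x"
  let ?c = "\<lambda>s i. coeff_at C (int d + int n - int s - int i)"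
  let ?R = "{(s, i). i \<le> d \<and> d \<le> s + i \<and> s + i \<le> d + n}"
  have lamC: "lam_poly n C lam = (\<lambda>x. \<Sum>k\<in>{..n}. lam ^ (n - k) * C k x)"
    and lamL: "lam_poly d L lam = (\<lambda>x. \<Sum>i\<in>{..d}. lam ^ (d - i) * L i x)"
    by (auto simp: lam_poly_def fun_eq_iff mult_ac)
  have smC: "smooth_fun_on S (\<lambda>x. \<Sum>k\<in>{..n}. lam ^ (n - k) * C k x)"
    by (rule smooth_sum) (use S C in auto)
  have "?D (lam_poly n C lam) x = (\<Sum>k\<le>n. lam ^ (n - k) * ?D (C k) x)"
    unfolding lamC using Dx_pow_sum[OF S, of "{..n}" C x 3] C x
    by (simp add: numeral_3_eq_3)
  also have "\<dots> = (\<Sum>s\<le>d + n. ?D (coeff_at C (int n - int s)) x * lam ^ s)"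
    by (rule sum.reindex_bij_witness_not_neutral[of "{}" "{n<..d + n}" _ "\<lambda>s. n - s" "\<lambda>k. n - k"])
      (auto simp: of_nat_diff)
  finally have 1: "?D (lam_poly n C lam) x
      = (\<Sum>s\<le>d + n. ?D (coeff_at C (int n - int s)) x * lam ^ s)" .
  have "bilin (lam_poly d L lam) (lam_poly n C lam) x
      = (\<Sum>i\<le>d. lam ^ (d - i) * bilin (L i) (\<lambda>x. \<Sum>k\<in>{..n}. lam ^ (n - k) * C k x) x)"
    unfolding lamC lamL by (rule bilin_sum_left) (use S L smC x in auto)
  also have "\<dots> = (\<Sum>i\<le>d. \<Sum>k\<le>n. bilin (L i) (C k) x * lam ^ (d - i + (n - k)))"
  proof (intro sum.cong refl)
    fix i assume i: "i \<in> {..d}"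
    have *: "bilin (L i) (\<lambda>x. \<Sum>k\<in>{..n}. lam ^ (n - k) * C k x) x
        = (\<Sum>k\<le>n. lam ^ (n - k) * bilin (L i) (C k) x)"
      by (rule bilin_sum_right) (use S L C x i in auto)
    show "lam ^ (d - i) * bilin (L i) (\<lambda>x. \<Sum>k\<in>{..n}. lam ^ (n - k) * C k x) x
        = (\<Sum>k\<le>n. bilin (L i) (C k) x * lam ^ (d - i + (n - k)))"
      unfolding * power_add sum_distrib_left by (simp only: mult_ac)
  qed
  also have "\<dots> = (\<Sum>(i, k)\<in>{..d} \<times> {..n}. bilin (L i) (C k) x * lam ^ (d - i + (n - k)))"
    by (rule sum.cartesian_product)
  \<comment> \<open>group the terms by the exponent \<open>s = (d - i) + (n - k)\<close>\<close>
  also have "\<dots> = (\<Sum>(s, i)\<in>?R. bilin (L i) (C (d + n - s - i)) x * lam ^ s)"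
    by (rule sum.reindex_bij_witness[of _ "\<lambda>(s, i). (i, d + n - s - i)" "\<lambda>(i, k). (d - i + (n - k), i)"])
      auto
  also have "\<dots> = (\<Sum>(s, i)\<in>Sigma {..d + n} (\<lambda>s. {d - s..d}). bilin (L i) (?c s i) x * lam ^ s)"
  proof (rule sum.mono_neutral_cong_left)
    show "?R \<subseteq> Sigma {..d + n} (\<lambda>s. {d - s..d})" by auto
    show "\<forall>p\<in>Sigma {..d + n} (\<lambda>s. {d - s..d}) - ?R.
        (case p of (s, i) \<Rightarrow> bilin (L i) (?c s i) x * lam ^ s) = 0"
    proof
      fix p assume p: "p \<in> Sigma {..d + n} (\<lambda>s. {d - s..d}) - ?R"
      obtain s i where si: "p = (s, i)" by fastforce
      with p have "?c s i = (\<lambda>x. 0)" by (intro coeff_at_neg) auto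
      then show "(case p of (s, i) \<Rightarrow> bilin (L i) (?c s i) x * lam ^ s) = 0" by (simp add: si)
    qed
    fix p assume p: "p \<in> ?R"
    obtain s i where si: "p = (s, i)" by fastforce
    have "int d + int n - int s - int i = int (d + n - s - i)" using p si by auto
    then have "?c s i = C (d + n - s - i)" by (simp only: coeff_at_nonneg of_nat_0_le_iff nat_int)
    then show "(case p of (s, i) \<Rightarrow> bilin (L i) (C (d + n - s - i)) x * lam ^ s)
        = (case p of (s, i) \<Rightarrow> bilin (L i) (?c s i) x * lam ^ s)" by (simp add: si)
  qed auto
  also have "\<dots> = (\<Sum>s\<le>d + n. \<Sum>i=d-s..d. bilin (L i) (?c s i) x * lam ^ s)"
    by (rule sum.Sigma[symmetric]) auto
  finally have 2: "bilin (lam_poly d L lam) (lam_poly n C lam) x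
      = (\<Sum>s\<le>d + n. (\<Sum>i=d-s..d. bilin (L i) (?c s i) x) * lam ^ s)"
    by (simp add: sum_distrib_right)
  show ?thesis unfolding soliton_lhs_def soliton_cond_def 1 2
    by (simp add: sum_subtractf left_diff_distrib mult.assoc flip: sum_distrib_left)
qed

lemma soliton_lhs_eq_0_iff:
  assumes "open S" "\<forall>i\<le>d. smooth_fun_on S (L i)"
    and "\<forall>k\<le>n. smooth_fun_on S (C k)" "x \<in> S"
  shows "(\<forall>lam. soliton_lhs d L n C lam x = 0) \<longleftrightarrow> (\<forall>s\<le>d + n. soliton_cond d L C n s x = 0)"
proof -
  have "soliton_lhs d L n C lam x = (\<Sum>s\<le>d + n. soliton_cond d L C n s x * lam ^ s)" for lam
    by (rule soliton_lhs_eq_sum_conds) (use assms in auto)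
  then show ?thesis by (simp only: polyfun_eq_0)
qed

lemma soliton_cond_cong:
  assumes "open S" "x \<in> S" "\<And>k y. k \<le> n \<Longrightarrow> y \<in> S \<Longrightarrow> B k y = C k y"
  shows "soliton_cond d L B n s x = soliton_cond d L C n s x"
proof -
  have eq: "coeff_at B j y = coeff_at C j y" if "j \<le> int n" "y \<in> S" for j y
    using that assms(3)[of "nat j" y] by (simp add: coeff_at_def)
  have "Dx (Dx (Dx (coeff_at B (int n - int s)))) x = Dx (Dx (Dx (coeff_at C (int n - int s)))) x"
    using Dx_pow_cong[OF assms(1) _ assms(2), of "coeff_at B (int n - int s)" _ 3] eq
    by (simp add: numeral_3_eq_3)
  moreover have "(\<Sum>i=d-s..d. bilin (L i) (coeff_at B (int d + int n - int s - int i)) x)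
      = (\<Sum>i=d-s..d. bilin (L i) (coeff_at C (int d + int n - int s - int i)) x)"
    by (intro sum.cong refl bilin_cong[OF assms(1,2)] eq) auto
  ultimately show ?thesis by (simp only: soliton_cond_def)
qed

text \<open>
  From the power \<open>\<lambda>\<^sup>d\<close> on, the coefficients of the soliton equation do not depend on the degree \<open>n\<close>
  and the power \<open>s\<close> separately.  This is why one recursion serves all degrees.
\<close>

lemma soliton_cond_shift:
  assumes "d \<le> s" "s \<le> d + n"
  shows "soliton_cond d L C n s = soliton_cond d L C (d + n - s) d"
  using assms by (simp add: soliton_cond_def of_nat_diff add_diff_eq)

section \<open>Linear combinations of the normalized solitons\<close>

text \<open>
  The coefficients of \<open>\<Sum>l. K l * lam_poly (n - l) A\<close>: a convolution, which does not depend on \<open>n\<close>.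
\<close>

definition comb :: "(nat \<Rightarrow> 'a::real_normed_field) \<Rightarrow> (nat \<Rightarrow> real \<Rightarrow> 'a) \<Rightarrow> nat \<Rightarrow> real \<Rightarrow> 'a" where
  "comb K A k = (\<lambda>x. \<Sum>l\<le>k. K l * A (k - l) x)"

lemma smooth_comb:
  assumes "open S" "\<forall>j\<le>k. smooth_fun_on S (A j)"
  shows "smooth_fun_on S (comb K A k)"
  unfolding comb_def by (rule smooth_sum) (use assms in auto)

lemma lam_poly_comb:
  "(\<Sum>l\<le>n. K l * lam_poly (n - l) A lam x) = lam_poly n (comb K A) lam x"
proof -
  have "(\<Sum>l\<le>n. K l * lam_poly (n - l) A lam x)
      = (\<Sum>l\<le>n. \<Sum>j\<le>n - l. K l * A j x * lam ^ (n - (l + j)))"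
    by (simp add: lam_poly_def sum_distrib_left mult.assoc)
  also have "\<dots> = (\<Sum>(l, j)\<in>{(l, j). l + j \<le> n}. K l * A j x * lam ^ (n - (l + j)))"
    by (subst sum.Sigma) (auto intro!: sum.cong)
  also have "\<dots> = lam_poly n (comb K A) lam x"
    by (simp add: sum.triangle_reindex_eq lam_poly_def comb_def sum_distrib_right)
  finally show ?thesis .
qed

text \<open>
  The index \<open>j\<close> is an integer here, and the range of summation is the same for all \<open>j \<le> n\<close>
  because coefficients of negative index vanish.  This makes \<open>soliton_cond\<close> of the combination a
  linear combination over one index set.
\<close>

lemma coeff_at_comb:
  assumes "j \<le> int n"
  shows "coeff_at (comb K A) j = (\<lambda>x. \<Sum>l\<le>n. K l * coeff_at A (j - int l) x)"
proof (cases "j < 0")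
  case False
  then obtain m where j: "j = int m" using nonneg_int_cases by (metis not_less)
  have "(\<Sum>l\<le>m. K l * A (m - l) x) = (\<Sum>l\<le>n. K l * coeff_at A (j - int l) x)" for x
    using assms j
    by (intro sum.mono_neutral_cong_left) (auto simp: nat_diff_distrib')
  then show ?thesis by (simp add: j comb_def)
qed auto

lemma soliton_cond_comb:
  assumes S: "open S" and L: "\<forall>i\<le>d. smooth_fun_on S (L i)"
    and A: "\<forall>k\<le>n. smooth_fun_on S (A k)" and x: "x \<in> S"
  shows "soliton_cond d L (comb K A) n s x = (\<Sum>l\<le>n. K l * soliton_cond d L A (n - l) s x)"
proof -
  let ?a = "\<lambda>j l. coeff_at A (j - int l)"
  have sm: "smooth_fun_on S (?a j l)" if "j \<le> int n" for j l
  proof (cases "j - int l < 0")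
    case False
    then show ?thesis using A that by simp
  qed (simp add: smooth_const)
  have "coeff_at (comb K A) (int n - int s) = (\<lambda>x. \<Sum>l\<le>n. K l * ?a (int n - int s) l x)"
    by (rule coeff_at_comb) simp
  then have "Dx (Dx (Dx (coeff_at (comb K A) (int n - int s)))) x
      = (\<Sum>l\<le>n. K l * Dx (Dx (Dx (?a (int n - int s) l))) x)"
    using Dx_pow_sum[OF S, of "{..n}" "?a (int n - int s)" x 3 K] x sm
    by (simp add: numeral_3_eq_3)
  moreover have "bilin (L i) (coeff_at (comb K A) (int d + int n - int s - int i)) x
      = (\<Sum>l\<le>n. K l * bilin (L i) (?a (int d + int n - int s - int i) l) x)" if "i \<in> {d-s..d}" for i
  proof -
    have le: "int d + int n - int s - int i \<le> int n" using that by auto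
    show ?thesis unfolding coeff_at_comb[OF le]
      by (rule bilin_sum_right) (use S L x sm[OF le] that in auto)
  qed
  then have "(\<Sum>i=d-s..d. bilin (L i) (coeff_at (comb K A) (int d + int n - int s - int i)) x)
      = (\<Sum>l\<le>n. K l * (\<Sum>i=d-s..d. bilin (L i) (?a (int d + int n - int s - int i) l) x))"
    by (simp only: sum_distrib_left sum.swap[of _ "{..n}"] cong: sum.cong)
  moreover have "(\<Sum>l\<le>n. K l * t l) - 2 * (\<Sum>l\<le>n. K l * u l) = (\<Sum>l\<le>n. K l * (t l - 2 * u l))"
    for t u :: "nat \<Rightarrow> 'a"
    by (simp add: sum_distrib_left sum_subtractf right_diff_distrib mult.left_commute)
  ultimately have "soliton_cond d L (comb K A) n s x
      = (\<Sum>l\<le>n. K l * (Dx (Dx (Dx (?a (int n - int s) l))) x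
          - 2 * (\<Sum>i=d-s..d. bilin (L i) (?a (int d + int n - int s - int i) l) x)))"
    by (simp only: soliton_cond_def)
  \<comment> \<open>shifting the coefficients by \<open>l\<close> amounts to lowering the degree from \<open>n\<close> to \<open>n - l\<close>\<close>
  also have "\<dots> = (\<Sum>l\<le>n. K l * soliton_cond d L A (n - l) s x)"
    by (intro sum.cong refl) (simp add: soliton_cond_def of_nat_diff algebra_simps)
  finally show ?thesis .
qed

section \<open>The recursion formula\<close>

lemma bilin_const_left:
  assumes "open S" "\<forall>x\<in>S. L0f x = L0" "smooth_fun_on S g" "x \<in> S"
  shows "bilin L0f g x = 2 * (L0 * Dx g x)"
proof -
  have "bilin L0f g x = bilin (\<lambda>_. L0) g x"
    by (rule bilin_cong) (use assms in auto)
  also have "\<dots> = 2 * (L0 * Dx g x)"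
    using bilin_eq[OF smooth_const[of S L0] assms(3,4)] by simp
  finally show ?thesis .
qed

text \<open>
  The differentiated recursion formula: as \<open>L 0\<close> is constant, the term with \<open>i = 0\<close> is
  \<open>2 * L0 * C\<^sub>k'\<close>, and only this term contains the coefficient with the highest index.
\<close>

lemma soliton_cond_d_eq_0_iff:
  assumes "open S" "\<forall>x\<in>S. L 0 x = L0" "smooth_fun_on S (C k)" "x \<in> S"
  shows "soliton_cond d L C k d x = 0 \<longleftrightarrow>
    4 * (L0 * Dx (C k) x) = Dx (Dx (Dx (coeff_at C (int k - int d)))) x
      - 2 * (\<Sum>i=1..d. bilin (L i) (coeff_at C (int k - int i)) x)"
proof -
  have "{0..d} = insert 0 {1..d}" by auto
  then have "soliton_cond d L C k d x = Dx (Dx (Dx (coeff_at C (int k - int d)))) x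
    - 2 * (\<Sum>i=1..d. bilin (L i) (coeff_at C (int k - int i)) x) - 4 * (L0 * Dx (C k) x)"
    using bilin_const_left[OF assms] by (simp add: soliton_cond_def algebra_simps)
  then show ?thesis by (simp only: right_minus_eq) (rule eq_commute)
qed

lemma normalized_recursion_step:
  assumes "normalized_recursion d L0 P" "k \<noteq> 0"
  obtains Q where "dtot Q = (\<Sum>i=1..d. dbilin (dvar i) (dcoeff_at P (int k - int i)))"
    "P k = dconst (- 1 / (2 * L0)) *
      (Q - dconst (1 / 2) * dtot (dtot (dcoeff_at P (int k - int d))))"
proof -
  have "1 \<le> k" using assms(2) by simp
  with assms(1) show ?thesis
    unfolding normalized_recursion_def zero_const_primitive_def using that by blast
qed

text \<open>
  A primitive is only known through its total derivative, so the induction has to pass from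
  \<open>dtot Q\<close> back to \<open>Q\<close>.
\<close>

lemma normalized_recursion_over:
  assumes "normalized_recursion d L0 P" "0 < d"
  shows "dpoly_over {1..d} (P k)"
proof (induction k rule: less_induct)
  case (less k)
  show ?case
  proof (cases "k = 0")
    case True
    then show ?thesis using assms by (simp add: normalized_recursion_def dpoly_over_dconst)
  next
    case False
    have IH: "dpoly_over {1..d} (dcoeff_at P (int k - int i))" if "0 < i" for i
      using less[of "nat (int k - int i)"] that False
      by (auto simp: dcoeff_at_def dpoly_over_zero)
    from assms(1) False obtain Q where Q:
      "dtot Q = (\<Sum>i=1..d. dbilin (dvar i) (dcoeff_at P (int k - int i)))"
      "P k = dconst (- 1 / (2 * L0)) *
          (Q - dconst (1 / 2) * dtot (dtot (dcoeff_at P (int k - int d))))"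
      by (rule normalized_recursion_step)
    have "dpoly_over {1..d} (dtot Q)"
      unfolding Q(1) by (intro dpoly_over_sum dpoly_over_dbilin dpoly_over_dvar IH) auto
    then show ?thesis unfolding Q(2)
      by (intro dpoly_over_mult dpoly_over_dconst dpoly_over_diff dpoly_over_dtot IH assms)
        (simp add: dpoly_over_dtot_iff)
  qed
qed

text \<open>
  Applying the total derivative to the recursion formula replaces the integral by its integrand and
  leaves an identity of differential polynomials in \<open>L 1, \<dots>, L d\<close>.  As these functions are
  smooth, evaluation carries the identity over to functions of \<open>x\<close>.
\<close>

lemma normalized_soliton_cond_eq_0:
  assumes rec: "normalized_recursion d L0 P" and d: "0 < d" and S: "open S"
    and L0: "L0 \<noteq> 0" "\<forall>x\<in>S. L 0 x = L0"
    and L: "\<forall>i\<in>{1..d}. smooth_fun_on S (L i)" and x: "x \<in> S"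
  shows "soliton_cond d L (\<lambda>k. deval L (P k)) k d x = 0"
proof -
  let ?A = "\<lambda>k. deval L (P k)"
  note over = normalized_recursion_over[OF rec d]
  have over_at: "dpoly_over {1..d} (dcoeff_at P j)" for j
    unfolding dcoeff_at_def using over dpoly_over_zero by auto
  have coeff_at: "coeff_at ?A j = deval L (dcoeff_at P j)" for j
    by (simp add: coeff_at_def dcoeff_at_def fun_eq_iff)
  have "4 * (L0 * Dx (?A k) x) = Dx (Dx (Dx (coeff_at ?A (int k - int d)))) x
      - 2 * (\<Sum>i=1..d. bilin (L i) (coeff_at ?A (int k - int i)) x)"
  proof (cases "k = 0")
    case True
    have "deval L (P 0) = (\<lambda>_. - 2 * L0)"
      using rec by (simp add: normalized_recursion_def fun_eq_iff)
    then show ?thesis using True d by simp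
  next
    case False
    let ?R = "dcoeff_at P (int k - int d)"
    from rec False obtain Q where Q:
      "dtot Q = (\<Sum>i=1..d. dbilin (dvar i) (dcoeff_at P (int k - int i)))"
      "P k = dconst (- 1 / (2 * L0)) * (Q - dconst (1 / 2) * dtot (dtot ?R))"
      by (rule normalized_recursion_step)
    have "dpoly_over {1..d} (dtot Q)"
      unfolding Q(1) by (intro dpoly_over_sum dpoly_over_dbilin dpoly_over_dvar over_at)
    then have overQ: "dpoly_over {1..d} Q" by (simp add: dpoly_over_dtot_iff)
    have "bilin (L i) (coeff_at ?A (int k - int i)) x
        = deval L (dbilin (dvar i) (dcoeff_at P (int k - int i))) x" if "i \<in> {1..d}" for i
    proof -
      have "deval L (dvar i) = L i" by (simp add: fun_eq_iff)
      then show ?thesis unfolding coeff_at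
        using bilin_deval[OF S L dpoly_over_dvar[OF that] over_at x] by simp
    qed
    then have sum: "(\<Sum>i=1..d. bilin (L i) (coeff_at ?A (int k - int i)) x) = deval L (dtot Q) x"
      by (simp add: Q(1) deval_sum)
    have third: "Dx (Dx (Dx (coeff_at ?A (int k - int d)))) x = deval L (dtot (dtot (dtot ?R))) x"
      unfolding coeff_at using Dx_pow_deval[OF S L over_at x, where k = 3]
      by (simp add: numeral_3_eq_3)
    have "(deval L Q has_vector_derivative deval L (dtot Q) x) (at x)"
      by (rule deval_has_vector_derivative[OF L overQ x])
    moreover have "(deval L (dtot (dtot ?R)) has_vector_derivative
        deval L (dtot (dtot (dtot ?R))) x) (at x)"
      by (rule deval_has_vector_derivative[OF L dpoly_over_dtot[OF dpoly_over_dtot[OF over_at]] x])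
    ultimately have "((\<lambda>y. - 1 / (2 * L0) * (deval L Q y - 1 / 2 * deval L (dtot (dtot ?R)) y))
        has_vector_derivative
        - 1 / (2 * L0) * (deval L (dtot Q) x - 1 / 2 * deval L (dtot (dtot (dtot ?R))) x)) (at x)"
      by (intro has_vector_derivative_mult_right has_vector_derivative_diff)
    moreover have "?A k = (\<lambda>y. - 1 / (2 * L0) * (deval L Q y - 1 / 2 * deval L (dtot (dtot ?R)) y))"
      unfolding Q(2) by (simp add: deval_mult deval_diff fun_eq_iff)
    ultimately have "Dx (?A k) x
        = - 1 / (2 * L0) * (deval L (dtot Q) x - 1 / 2 * deval L (dtot (dtot (dtot ?R))) x)"
      by (simp only: vector_derivative_at)
    then show ?thesis unfolding sum third using L0(1) by (simp add: field_simps)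
  qed
  then show ?thesis
    using soliton_cond_d_eq_0_iff[of S L L0 ?A k x d] S L0(2) smooth_deval[OF S L over] x by blast
qed

section \<open>Every soliton is a combination of normalized solitons\<close>

text \<open>
  Induction on the number of coefficients already matched.  If \<open>E\<close> is the combination with the
  constants found so far and the new one set to 0, then \<open>E\<close> and \<open>B\<close> satisfy the same recursion
  with the same earlier coefficients; their next coefficients differ by a constant \<open>c\<close>, and
  \<open>c / a\<close> is the new constant of the combination because it multiplies \<open>A 0 = a\<close>.
\<close>

lemma comb_of_soliton_conds:
  assumes S: "open S" "is_interval S"
    and L0: "L0 \<noteq> 0" "\<forall>x\<in>S. L 0 x = L0" and d: "0 < d"
    and L: "\<forall>i\<le>d. smooth_fun_on S (L i)"
    and A: "\<forall>k. smooth_fun_on S (A k)" "a \<noteq> 0" "\<forall>x\<in>S. A 0 x = a"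
      "\<And>k x. x \<in> S \<Longrightarrow> soliton_cond d L A k d x = 0"
    and B: "\<forall>k\<le>n. smooth_fun_on S (B k)" "\<forall>x\<in>S. B 0 x = b"
      "\<And>k x. k \<le> n \<Longrightarrow> x \<in> S \<Longrightarrow> soliton_cond d L B k d x = 0"
  shows "m \<le> n \<Longrightarrow> \<exists>K. \<forall>k\<le>m. \<forall>x\<in>S. B k x = comb K A k x"
proof (induction m)
  case 0
  show ?case
    by (rule exI[of _ "\<lambda>_. b / a"]) (use A B in \<open>simp add: comb_def\<close>)
next
  case (Suc m)
  then obtain K where K: "\<And>k x. k \<le> m \<Longrightarrow> x \<in> S \<Longrightarrow> B k x = comb K A k x"
    by fastforce
  define E where "E = comb (K(Suc m := 0)) A"
  have comb_upd: "comb (K(Suc m := c)) A k = comb K A k" if "k \<le> m" for c k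
    using that by (auto simp: comb_def fun_eq_iff intro!: sum.cong)
  have BE: "B k x = E k x" if "k \<le> m" "x \<in> S" for k x
    using K that comb_upd by (simp add: E_def)
  have smE: "smooth_fun_on S (E (Suc m))" unfolding E_def by (rule smooth_comb) (use S A in auto)
  have smB: "smooth_fun_on S (B (Suc m))" using B(1) Suc.prems by auto
  have eq_at: "coeff_at B (int (Suc m) - int i) y = coeff_at E (int (Suc m) - int i) y"
    if "0 < i" "y \<in> S" for i y
    using BE[of "nat (int (Suc m) - int i)" y] that by (auto simp: coeff_at_def)
  have Dx_eq: "Dx (B (Suc m)) x = Dx (E (Suc m)) x" if x: "x \<in> S" for x
  proof -
    have "Dx (Dx (Dx (coeff_at B (int (Suc m) - int d)))) x
        = Dx (Dx (Dx (coeff_at E (int (Suc m) - int d)))) x"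
      using Dx_pow_cong[OF S(1) eq_at[OF d] x, where k = 3] by (simp add: numeral_3_eq_3)
    moreover have "(\<Sum>i=1..d. bilin (L i) (coeff_at B (int (Suc m) - int i)) x)
        = (\<Sum>i=1..d. bilin (L i) (coeff_at E (int (Suc m) - int i)) x)"
      by (intro sum.cong refl bilin_cong[OF S(1) x] eq_at) auto
    moreover have "soliton_cond d L E (Suc m) d x = 0"
      unfolding E_def using soliton_cond_comb[OF S(1) L _ x] A(1,4) x by simp
    moreover have "soliton_cond d L B (Suc m) d x = 0" by (rule B(3)[OF Suc.prems x])
    ultimately have "4 * (L0 * Dx (B (Suc m)) x) = 4 * (L0 * Dx (E (Suc m)) x)"
      using soliton_cond_d_eq_0_iff[of S L L0 B "Suc m" x d] smB
        soliton_cond_d_eq_0_iff[of S L L0 E "Suc m" x d] smE S(1) L0(2) x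
      by (simp only:)
    then show ?thesis using L0(1) by simp
  qed
  obtain c where c: "\<And>x. x \<in> S \<Longrightarrow> B (Suc m) x - E (Suc m) x = c"
  proof (rule has_vector_derivative_zero_constant[of S "\<lambda>x. B (Suc m) x - E (Suc m) x"])
    show "convex S" using S(2) by (rule is_interval_convex)
    fix x assume x: "x \<in> S"
    have "((\<lambda>x. B (Suc m) x - E (Suc m) x) has_vector_derivative
        Dx (B (Suc m)) x - Dx (E (Suc m)) x) (at x)"
      using has_vector_derivative_diff[OF smooth_has_vector_derivative[OF smB x, of 0]
          smooth_has_vector_derivative[OF smE x, of 0]] by simp
    then show "((\<lambda>x. B (Suc m) x - E (Suc m) x) has_vector_derivative 0) (at x within S)"
      by (simp add: Dx_eq[OF x] has_vector_derivative_at_within)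
  qed (use that in blast)
  define K' where "K' = K(Suc m := c / a)"
  have "B (Suc m) x = comb K' A (Suc m) x" if x: "x \<in> S" for x
  proof -
    have "comb K' A (Suc m) x = E (Suc m) x + c"
      using A(2,3) x by (simp add: K'_def E_def comb_def)
    then show ?thesis using c[OF x] by (simp add: algebra_simps)
  qed
  then have "\<forall>k\<le>Suc m. \<forall>x\<in>S. B k x = comb K' A k x"
    using K comb_upd by (auto simp: K'_def le_Suc_eq)
  then show ?case by blast
qed

theorem theorem1p1:
  fixes S :: "real set" and d n :: nat
    and L A :: "nat \<Rightarrow> real \<Rightarrow> 'a::real_normed_field" and L0 :: 'a
  assumes S: "open S" "is_interval S"
    and d: "0 < d"
    and L0: "L0 \<noteq> 0" "\<forall>x\<in>S. L 0 x = L0"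
    and L: "\<forall>i\<in>{1..d}. smooth_fun_on S (L i)"
    and A: "normalized_coeffs S d L0 L A"
  shows "(\<forall>B. soliton S d L n B \<longrightarrow>
        (\<exists>K :: nat \<Rightarrow> 'a. \<forall>lam. \<forall>x\<in>S.
           lam_poly n B lam x = (\<Sum>l\<le>n. K l * lam_poly (n - l) A lam x)))
    \<and> (\<forall>(K :: nat \<Rightarrow> 'a) B. K 0 \<noteq> 0 \<and>
        (\<forall>lam. \<forall>x\<in>S. lam_poly n B lam x = (\<Sum>l\<le>n. K l * lam_poly (n - l) A lam x)) \<longrightarrow>
        (soliton S d L n B \<longleftrightarrow>
           (\<forall>s<d. \<forall>x\<in>S. (\<Sum>l\<le>n. K l * soliton_cond d L A (n - l) s x) = 0)) \<and>
        (\<forall>s<d. \<forall>x\<in>S.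
           soliton_cond d L B n s x = (\<Sum>l\<le>n. K l * soliton_cond d L A (n - l) s x)) \<and>
        (\<forall>lam. \<forall>x\<in>S.
           soliton_lhs d L n B lam x = (\<Sum>s<d. soliton_cond d L B n s x * lam ^ s)) \<and>
        (\<forall>l\<le>n. \<forall>lam. \<forall>x\<in>S.
           soliton_lhs d L (n - l) A lam x = (\<Sum>s<d. soliton_cond d L A (n - l) s x * lam ^ s)))"
proof (intro conjI[of "\<forall>B. _ B"] allI impI)
  from A obtain P where rec: "normalized_recursion d L0 P"
    and AP: "\<And>k x. x \<in> S \<Longrightarrow> A k x = deval L (P k) x"
    unfolding normalized_coeffs_def by blast
  have "smooth_fun_on S (L 0)"
    by (rule smooth_cong[OF S(1) smooth_const[of S L0]]) (use L0 in auto)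
  then have Ls: "\<forall>i\<le>d. smooth_fun_on S (L i)"
    using L by (metis One_nat_def Suc_leI atLeastAtMost_iff gr0I)
  have "smooth_fun_on S (A k)" for k
    by (rule smooth_cong[OF S(1) smooth_deval[OF S(1) L normalized_recursion_over[OF rec d]]])
      (simp add: AP)
  then have As: "\<forall>k. smooth_fun_on S (A k)" by blast
  have A0: "\<forall>x\<in>S. A 0 x = - 2 * L0"
    using rec AP by (simp add: normalized_recursion_def)
  have Ad: "soliton_cond d L A k d x = 0" if "x \<in> S" for k x
    using soliton_cond_cong[OF S(1) that AP, of k]
      normalized_soliton_cond_eq_0[where L = L and P = P, OF rec d S(1) L0 L that] by simp
  \<comment> \<open>both for the normalized solitons and for their combinations, only the powers below \<open>d\<close> survive\<close>
  have lhs: "soliton_lhs d L m C lam x = (\<Sum>s<d. soliton_cond d L C m s x * lam ^ s)"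
    if C: "\<forall>k\<le>m. smooth_fun_on S (C k)" and x: "x \<in> S"
      and C0: "\<And>k. k \<le> m \<Longrightarrow> soliton_cond d L C k d x = 0" for m C lam x
  proof -
    have "soliton_cond d L C m s x = 0" if "s \<in> {..d + m} - {..<d}" for s
      using soliton_cond_shift[of d s m L C] C0[of "d + m - s"] that by auto
    then show ?thesis
      unfolding soliton_lhs_eq_sum_conds[OF S(1) Ls C x]
      by (intro sum.mono_neutral_right) auto
  qed
  {
    fix B assume B: "soliton S d L n B"
    then obtain b where b: "\<forall>x\<in>S. B 0 x = b" unfolding soliton_def by blast
    have Bs: "\<forall>k\<le>n. smooth_fun_on S (B k)" using B unfolding soliton_def by blast
    have "soliton_cond d L B k d x = 0" if k: "k \<le> n" and x: "x \<in> S" for k x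
    proof -
      have "\<forall>s\<le>d + n. soliton_cond d L B n s x = 0"
        using soliton_lhs_eq_0_iff[OF S(1) Ls Bs x] B x unfolding soliton_def by blast
      then have "soliton_cond d L B n (d + n - k) x = 0" by simp
      then show ?thesis using soliton_cond_shift[of d "d + n - k" n L B] k by simp
    qed
    from comb_of_soliton_conds[OF S L0 d Ls As _ A0 Ad Bs b this order_refl] L0(1)
    obtain K where "\<forall>k\<le>n. \<forall>x\<in>S. B k x = comb K A k x" by auto
    then have "lam_poly n B lam x = lam_poly n (comb K A) lam x" if "x \<in> S" for lam x
      using lam_poly_eq_iff that by metis
    then show "\<exists>K. \<forall>lam. \<forall>x\<in>S. lam_poly n B lam x = (\<Sum>l\<le>n. K l * lam_poly (n - l) A lam x)"
      unfolding lam_poly_comb by blast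
  }
  fix K :: "nat \<Rightarrow> 'a" and B
  assume "K 0 \<noteq> 0 \<and>
    (\<forall>lam. \<forall>x\<in>S. lam_poly n B lam x = (\<Sum>l\<le>n. K l * lam_poly (n - l) A lam x))"
  then have K0: "K 0 \<noteq> 0"
    and "\<And>lam x. x \<in> S \<Longrightarrow> lam_poly n B lam x = lam_poly n (comb K A) lam x"
    unfolding lam_poly_comb by auto
  then have BK: "B k x = comb K A k x" if "k \<le> n" "x \<in> S" for k x
    using lam_poly_eq_iff that by metis
  have "smooth_fun_on S (B k)" if "k \<le> n" for k
    by (rule smooth_cong[OF S(1) smooth_comb[OF S(1)]]) (use As BK that in auto)
  then have Bs: "\<forall>k\<le>n. smooth_fun_on S (B k)" by blast
  have cond: "soliton_cond d L B m s x = (\<Sum>l\<le>m. K l * soliton_cond d L A (m - l) s x)"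
    if "m \<le> n" "x \<in> S" for m s x
  proof -
    have "soliton_cond d L B m s x = soliton_cond d L (comb K A) m s x"
      by (rule soliton_cond_cong[OF S(1) that(2)]) (use BK that(1) in auto)
    then show ?thesis using soliton_cond_comb[OF S(1) Ls _ that(2)] As by simp
  qed
  have lhsB: "soliton_lhs d L n B lam x = (\<Sum>s<d. soliton_cond d L B n s x * lam ^ s)"
    if "x \<in> S" for lam x
    by (rule lhs[OF Bs that]) (auto simp: cond that Ad)
  have "soliton S d L n B \<longleftrightarrow> (\<forall>x\<in>S. \<forall>lam. soliton_lhs d L n B lam x = 0)"
  proof -
    have "\<forall>x\<in>S. B 0 x = K 0 * (- 2 * L0)"
      using BK[of 0] A0 by (simp add: comb_def)
    moreover have "K 0 * (- 2 * L0) \<noteq> 0" using K0 L0 by simp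
    ultimately show ?thesis unfolding soliton_def using Bs by blast
  qed
  also have "\<dots> \<longleftrightarrow> (\<forall>s<d. \<forall>x\<in>S. soliton_cond d L B n s x = 0)"
  proof -
    have "(\<forall>lam. soliton_lhs d L n B lam x = 0) \<longleftrightarrow> (\<forall>s<d. soliton_cond d L B n s x = 0)"
      if x: "x \<in> S" for x
    proof
      assume "\<forall>lam. soliton_lhs d L n B lam x = 0"
      then show "\<forall>s<d. soliton_cond d L B n s x = 0"
        using soliton_lhs_eq_0_iff[OF S(1) Ls Bs x] by auto
    qed (simp add: lhsB[OF x])
    then show ?thesis by blast
  qed
  finally have "soliton S d L n B \<longleftrightarrow> (\<forall>s<d. \<forall>x\<in>S. soliton_cond d L B n s x = 0)" .
  then have "soliton S d L n B \<longleftrightarrow>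
      (\<forall>s<d. \<forall>x\<in>S. (\<Sum>l\<le>n. K l * soliton_cond d L A (n - l) s x) = 0)"
    by (simp add: cond)
  moreover have "\<forall>s<d. \<forall>x\<in>S.
      soliton_cond d L B n s x = (\<Sum>l\<le>n. K l * soliton_cond d L A (n - l) s x)"
    by (simp add: cond)
  moreover have "\<forall>lam. \<forall>x\<in>S. soliton_lhs d L n B lam x = (\<Sum>s<d. soliton_cond d L B n s x * lam ^ s)"
    using lhsB by blast
  moreover have "\<forall>l\<le>n. \<forall>lam. \<forall>x\<in>S.
      soliton_lhs d L (n - l) A lam x = (\<Sum>s<d. soliton_cond d L A (n - l) s x * lam ^ s)"
  proof (intro allI impI ballI)
    fix l lam x assume x: "x \<in> S"
    show "soliton_lhs d L (n - l) A lam x = (\<Sum>s<d. soliton_cond d L A (n - l) s x * lam ^ s)"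
      by (rule lhs[OF _ x Ad[OF x]]) (simp add: As)
  qed
  ultimately show "(soliton S d L n B \<longleftrightarrow>
       (\<forall>s<d. \<forall>x\<in>S. (\<Sum>l\<le>n. K l * soliton_cond d L A (n - l) s x) = 0)) \<and>
    (\<forall>s<d. \<forall>x\<in>S. soliton_cond d L B n s x = (\<Sum>l\<le>n. K l * soliton_cond d L A (n - l) s x)) \<and>
    (\<forall>lam. \<forall>x\<in>S. soliton_lhs d L n B lam x = (\<Sum>s<d. soliton_cond d L B n s x * lam ^ s)) \<and>
    (\<forall>l\<le>n. \<forall>lam. \<forall>x\<in>S.
      soliton_lhs d L (n - l) A lam x = (\<Sum>s<d. soliton_cond d L A (n - l) s x * lam ^ s))"
    by blast
qed

end
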